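(* Let $q$ be a power of an odd prime, let $n \ge 2$ be an integer, let $\lambda \in \mathbb{F}_q^{*}$, and let $\mathcal{A}, \mathcal{B} \subseteq \mathbb{F}_{q^n}$. Suppose that $|\mathcal{A}||\mathcal{B}| \ge q^{n+2}$. Then there exist $X \in \mathcal{A}$ and $Y \in \mathcal{B}$ such that $N(X+Y) = \lambda$.
   Context: $\mathbb{F}_q$ is the finite field with $q$ elements and $\mathbb{F}_{q^n}$ is its extension of degree $n$. $N = N_{\mathbb{F}_{q^n}/\mathbb{F}_q}$ is the norm map, $N(X) = \prod_{i=0}^{n-1} X^{q^i} = X^{(q^n-1)/(q-1)}$, extended by $N(0)=0$. *)

theory Defs
  imports "HOL-Number_Theory.Number_Theory" "HOL-Library.Cardinality"
begin

locale field_embedding =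
  fixes \<iota> :: "'k::field \<Rightarrow> 'l::field"
  assumes add: "\<iota> (x + y) = \<iota> x + \<iota> y"
    and mult: "\<iota> (x * y) = \<iota> x * \<iota> y"
    and one: "\<iota> 1 = 1"
begin

lemma vector_space: "vector_space (\<lambda>c x. \<iota> c * x)"
  by unfold_locales (auto simp: add mult one algebra_simps)

end

text \<open>The degree is the dimension of \<open>'l\<close> as a vector space over the image of \<open>\<iota>\<close>.\<close>

definition extension_degree :: "('k::field \<Rightarrow> 'l::field) \<Rightarrow> nat" where
  "extension_degree \<iota> = vector_space.dim (\<lambda>c x. \<iota> c * x) UNIV"

text \<open>
  The norm from the field with \<open>q ^ n\<close> elements to the one with \<open>q\<close> elements, with its value
  regarded as an element of the larger field.
\<close>

definition norm_map :: "nat \<Rightarrow> nat \<Rightarrow> 'l::field \<Rightarrow> 'l" where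
  "norm_map q n X = (\<Prod>i<n. X ^ (q ^ i))"

lemma norm_map_eq_power:
  assumes "q \<ge> 2"
  shows "norm_map q n X = X ^ ((q ^ n - 1) div (q - 1))"
proof -
  have "q ^ n - 1 = (q - 1) * (\<Sum>i<n. q ^ i)"
  proof (induction n)
    case (Suc n)
    have "q ^ Suc n - 1 = (q - 1) * q ^ n + (q ^ n - 1)"
      using assms by (simp add: diff_mult_distrib)
    then show ?case
      using Suc by (simp add: algebra_simps)
  qed simp
  then have "(q ^ n - 1) div (q - 1) = (\<Sum>i<n. q ^ i)"
    using assms by simp
  then show ?thesis
    by (simp add: norm_map_def power_sum)
qed

lemma norm_map_0: "q \<ge> 1 \<Longrightarrow> n \<ge> 1 \<Longrightarrow> norm_map q n 0 = 0"
  by (auto simp: norm_map_def intro!: exI[of _ 0])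

end

theory Submission
  imports Defs "HOL-Computational_Algebra.Polynomial" "HOL-Analysis.L2_Norm"
begin

text \<open>
  Let \<open>F\<close> be the field with \<open>q ^ n\<close> elements and \<open>d = 1 + q + \<dots> + q ^ (n - 1)\<close>, so that the norm
  is \<open>X \<mapsto> X ^ d\<close>. The fibre \<open>S\<close> of the norm over \<open>\<lambda>\<close> behaves like a random set with respect to
  sums, because its Fourier coefficients at all nonzero frequencies are at most \<open>q ^ (n / 2)\<close>.
  This square root bound is a consequence of symmetry. The set \<open>S\<close> is stable under multiplication by
  the group \<open>H\<close> of elements of norm \<open>1\<close>, so the coefficient at a frequency \<open>b \<noteq> 0\<close> is repeated at
  each of the \<open>card H\<close> frequencies in \<open>b H\<close>. By Plancherel the squares of all
  coefficients add up to \<open>q ^ n * card S\<close>. Since \<open>card H = card S = d\<close>, each square is at most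
  \<open>q ^ n\<close> (\<open>fourier_bound_of_dilation_invariant\<close>).

  If no sum \<open>X + Y\<close> with \<open>X \<in> A\<close> and \<open>Y \<in> B\<close> lay in \<open>S\<close>, the number of such sums, expanded in
  characters, would be \<open>0\<close>. Its term at frequency \<open>0\<close>, of size \<open>card S * card A * card B\<close>, would then be
  cancelled by the other terms, and Cauchy-Schwarz together with Plancherel for \<open>A\<close> and \<open>B\<close> gives
  \<open>d\<^sup>2 * card A * card B \<le> q ^ (3 * n)\<close> (\<open>sumset_avoidance_bound\<close>). This contradicts
  \<open>card A * card B \<ge> q ^ (n + 2)\<close>, because \<open>d > q ^ (n - 1)\<close>.

  Two facts feed this argument: \<open>F\<close> has a nontrivial additive character, and all fibres of the norm over
  the nonzero elements of the smaller field have exactly \<open>d\<close> elements (\<open>card_power_fibre\<close>).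
\<close>

section \<open>Fourier analysis on a finite field\<close>

locale nontrivial_additive_character =
  fixes \<psi> :: "'a::{field,finite} \<Rightarrow> complex"
  assumes add: "\<psi> (x + y) = \<psi> x * \<psi> y"
    and norm_eq_1: "norm (\<psi> x) = 1"
    and nontrivial: "\<exists>x. \<psi> x \<noteq> 1"
begin

lemma zero [simp]: "\<psi> 0 = 1"
proof -
  have "\<psi> 0 \<noteq> 0"
    using norm_eq_1[of 0] by auto
  then show ?thesis
    using add[of 0 0] by simp
qed

lemma cnj_eq: "cnj (\<psi> x) = \<psi> (- x)"
proof -
  have "\<psi> x * \<psi> (- x) = 1"
    using add[of x "- x"] by simp
  moreover have "\<psi> x * cnj (\<psi> x) = 1"
    by (simp add: complex_norm_square[symmetric] norm_eq_1)
  ultimately show ?thesis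
    by (metis mult_cancel_left mult_zero_left zero_neq_one)
qed

lemma sum_dilates: "(\<Sum>b\<in>UNIV. \<psi> (b * x)) = (if x = 0 then of_nat CARD('a) else 0)"
proof (cases "x = 0")
  case False
  obtain z where z: "\<psi> z \<noteq> 1"
    using nontrivial by blast
  \<comment> \<open>Translating the summation variable multiplies the sum by a number other than \<open>1\<close>.\<close>
  have "(\<Sum>b\<in>UNIV. \<psi> (b * x)) = (\<Sum>b\<in>UNIV. \<psi> ((b + z / x) * x))"
    by (rule sum.reindex_bij_witness[of _ "\<lambda>b. b + z / x" "\<lambda>b. b - z / x"]) auto
  also have "\<dots> = \<psi> z * (\<Sum>b\<in>UNIV. \<psi> (b * x))"
    using False by (simp add: distrib_right add sum_distrib_left mult.commute[of "\<psi> z"])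
  finally show ?thesis
    using z False by simp
qed simp

text \<open>
  The characters \<open>x \<mapsto> \<psi> (b * x)\<close> are orthogonal by \<open>sum_dilates\<close>, so \<open>b\<close> serves as the frequency.
\<close>

definition fourier :: "'a set \<Rightarrow> 'a \<Rightarrow> complex" where
  "fourier A b = (\<Sum>a\<in>A. \<psi> (b * a))"

lemma fourier_0: "fourier A 0 = of_nat (card A)"
  by (simp add: fourier_def)

lemma plancherel: "(\<Sum>b\<in>UNIV. (norm (fourier A b))\<^sup>2) = real (CARD('a) * card A)"
proof -
  have "complex_of_real (\<Sum>b\<in>UNIV. (norm (fourier A b))\<^sup>2)
      = (\<Sum>b\<in>UNIV. \<Sum>x\<in>A. \<Sum>y\<in>A. \<psi> (b * (x - y)))"
    unfolding of_real_sum complex_norm_square fourier_def cnj_sum sum_product cnj_eq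
    by (simp add: algebra_simps flip: add)
  also have "\<dots> = (\<Sum>x\<in>A. \<Sum>y\<in>A. \<Sum>b\<in>UNIV. \<psi> (b * (x - y)))"
    by (subst sum.swap) (intro sum.cong refl sum.swap)
  also have "\<dots> = (\<Sum>x\<in>A. of_nat CARD('a))"
    by (simp add: sum_dilates)
  also have "\<dots> = complex_of_real (real (CARD('a) * card A))"
    by simp
  finally show ?thesis
    using of_real_eq_iff by blast
qed

text \<open>
  The coefficients of \<open>S\<close> at the \<open>card H\<close> distinct frequencies \<open>b * h\<close> all agree, so Plancherel
  leaves each of them at most a share \<open>1 / card H\<close> of the total \<open>CARD('a) * card S\<close>.
\<close>

lemma fourier_bound_of_dilation_invariant:
  assumes stable: "\<And>h. h \<in> H \<Longrightarrow> (*) h ` S = S"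
    and "0 \<notin> H" and card: "card S \<le> card H" and b: "b \<noteq> 0"
  shows "(norm (fourier S b))\<^sup>2 \<le> CARD('a)"
proof (cases "H = {}")
  case True
  then show ?thesis
    using card by (simp add: fourier_def)
next
  case False
  have same: "fourier S (b * h) = fourier S b" if "h \<in> H" for h
  proof -
    have "h \<noteq> 0"
      using that \<open>0 \<notin> H\<close> by auto
    then have "inj_on ((*) h) S"
      by (simp add: inj_on_def)
    then have "fourier ((*) h ` S) b = fourier S (b * h)"
      by (simp add: fourier_def sum.reindex mult.assoc)
    then show ?thesis
      using stable[OF that] by simp
  qed
  have inj: "inj_on ((*) b) H"
    using b by (simp add: inj_on_def)
  have "card H * (norm (fourier S b))\<^sup>2 = (\<Sum>c\<in>(*) b ` H. (norm (fourier S c))\<^sup>2)"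
    by (simp add: sum.reindex[OF inj] same)
  also have "\<dots> \<le> (\<Sum>c\<in>UNIV. (norm (fourier S c))\<^sup>2)"
    by (intro sum_mono2) auto
  also have "\<dots> \<le> card H * real CARD('a)"
    using card by (simp add: plancherel mult.commute mult_left_mono)
  finally show ?thesis
    using False by (simp add: card_gt_0_iff)
qed

text \<open>
  This is the expander mixing lemma for the sum graph of \<open>S\<close>, in the case of two sets with no edge between them.
\<close>

lemma sumset_avoidance_bound:
  assumes avoid: "\<And>x y. x \<in> A \<Longrightarrow> y \<in> B \<Longrightarrow> x + y \<notin> S"
    and small: "\<And>b. b \<noteq> 0 \<Longrightarrow> (norm (fourier S b))\<^sup>2 \<le> CARD('a)"
  shows "(card S)\<^sup>2 * (card A * card B) \<le> CARD('a) ^ 3"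
proof (cases "card A * card B = 0")
  case False
  define N where "N = real CARD('a)"
  define f where "f b = fourier A b * fourier B b * cnj (fourier S b)" for b
  have N: "N > 0"
    by (simp add: N_def)
  \<comment> \<open>The sum of \<open>f\<close> is \<open>CARD('a)\<close> times the number of \<open>(x, y, s)\<close> with \<open>x + y = s\<close>.\<close>
  have "(\<Sum>b\<in>UNIV. f b) = (\<Sum>b\<in>UNIV. \<Sum>x\<in>A. \<Sum>y\<in>B. \<Sum>s\<in>S. \<psi> (b * (x + y - s)))"
    unfolding f_def fourier_def cnj_sum sum_product cnj_eq
    by (simp add: sum_distrib_left sum_distrib_right algebra_simps sum.swap[of _ S] flip: add)
  also have "\<dots> = (\<Sum>x\<in>A. \<Sum>y\<in>B. \<Sum>s\<in>S. \<Sum>b\<in>UNIV. \<psi> (b * (x + y - s)))"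
    by (simp only: sum.swap[where A = UNIV and B = A] sum.swap[where A = UNIV and B = B]
        sum.swap[where A = UNIV and B = S])
  also have "\<dots> = 0"
    unfolding sum_dilates using avoid by (intro sum.neutral ballI) auto
  finally have "f 0 = - (\<Sum>b\<in>UNIV - {0}. f b)"
    by (simp add: sum.remove[of UNIV 0] add_eq_0_iff2)
  then have "norm (f 0) \<le> (\<Sum>b\<in>UNIV - {0}. norm (f b))"
    by (simp add: norm_sum)
  also have "\<dots> \<le> (\<Sum>b\<in>UNIV - {0}. sqrt N * (norm (fourier A b) * norm (fourier B b)))"
  proof (intro sum_mono)
    fix b :: 'a assume "b \<in> UNIV - {0}"
    then have "norm (fourier S b) \<le> sqrt N"
      using small[of b] by (simp add: N_def real_le_rsqrt)
    then show "norm (f b) \<le> sqrt N * (norm (fourier A b) * norm (fourier B b))"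
      by (simp add: f_def norm_mult mult.commute mult_right_mono)
  qed
  also have "\<dots> \<le> (\<Sum>b\<in>UNIV. sqrt N * (norm (fourier A b) * norm (fourier B b)))"
    using N by (intro sum_mono2) auto
  also have "\<dots> \<le> sqrt N * (L2_set (\<lambda>b. norm (fourier A b)) UNIV * L2_set (\<lambda>b. norm (fourier B b)) UNIV)"
    using N L2_set_mult_ineq[of "\<lambda>b. norm (fourier A b)" "\<lambda>b. norm (fourier B b)" UNIV]
    by (simp add: sum_distrib_left[symmetric])
  also have "\<dots> = sqrt (N ^ 3 * (card A * card B))"
    by (simp add: L2_set_def plancherel real_sqrt_mult[symmetric] N_def power3_eq_cube mult_ac)
  finally have "real (card S * (card A * card B)) \<le> sqrt (N ^ 3 * (card A * card B))"
    by (simp add: f_def fourier_0 norm_mult mult_ac)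
  then have "(real (card S * (card A * card B)))\<^sup>2 \<le> (sqrt (N ^ 3 * (card A * card B)))\<^sup>2"
    by (rule power_mono) simp
  also have "\<dots> = N ^ 3 * (card A * card B)"
    using N by (intro real_sqrt_pow2) simp
  finally have "(real (card S * (card A * card B)))\<^sup>2 \<le> N ^ 3 * (card A * card B)" .
  then have "real ((card S)\<^sup>2 * (card A * card B)) * (card A * card B) \<le> real (CARD('a) ^ 3) * (card A * card B)"
    by (simp add: N_def power2_eq_square mult_ac)
  then have "real ((card S)\<^sup>2 * (card A * card B)) \<le> real (CARD('a) ^ 3)"
  proof (rule mult_right_le_imp_le)
    show "0 < real (card A * card B)"
      using False by (simp only: of_nat_0_less_iff neq0_conv)
  qed
  then show ?thesis
    by (simp only: of_nat_le_iff)
qed auto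

end

text \<open>
  Choose an additive subgroup \<open>K\<close> maximal among those that do not contain \<open>1\<close>. Maximality forces every element
  to differ from an integer by an element of \<open>K\<close>, and an integer lies in \<open>K\<close> only if the
  characteristic \<open>p\<close> divides it. So the quotient by \<open>K\<close> is cyclic of order \<open>p\<close> and generated by \<open>1\<close>, and
  sending \<open>1\<close> to a primitive root of unity of order \<open>p\<close> gives the character.
\<close>

lemma exists_nontrivial_additive_character:
  "\<exists>\<psi> :: 'a::{field,finite} \<Rightarrow> complex. nontrivial_additive_character \<psi>"
proof -
  define p where "p = CHAR('a)"
  have p: "prime p"
    unfolding p_def by (rule prime_CHAR_semidom) (simp add: finite_imp_CHAR_pos)
  define subgroup where "subgroup K \<longleftrightarrow> 0 \<in> K \<and> (\<forall>x\<in>K. \<forall>y\<in>K. x - y \<in> K)" for K :: "'a set"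
  have "\<exists>K\<in>{K. subgroup K \<and> 1 \<notin> K}. \<forall>L\<in>{K. subgroup K \<and> 1 \<notin> K}. K \<subseteq> L \<longrightarrow> K = L"
    by (rule finite_has_maximal) (auto simp: subgroup_def intro!: exI[of _ "{0}"])
  then obtain K where K: "subgroup K" "1 \<notin> K"
    and maximal: "\<And>L. subgroup L \<Longrightarrow> 1 \<notin> L \<Longrightarrow> K \<subseteq> L \<Longrightarrow> K = L"
    by auto
  have K_diff: "x - y \<in> K" if "x \<in> K" "y \<in> K" for x y
    using K(1) that by (auto simp: subgroup_def)
  have K_0: "0 \<in> K"
    using K(1) by (auto simp: subgroup_def)
  have K_minus: "- x \<in> K" if "x \<in> K" for x
    using K_diff[OF K_0 that] by simp
  have K_add: "x + y \<in> K" if "x \<in> K" "y \<in> K" for x y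
    using K_diff[OF that(1) K_minus[OF that(2)]] by simp
  have K_nat: "of_nat i * x \<in> K" if "x \<in> K" for i x
    by (induction i) (auto simp: K_0 distrib_right intro!: K_add that)
  have K_int: "of_int i * x \<in> K" if "x \<in> K" for i x
    by (cases i rule: int_cases2) (use K_minus[OF K_nat[OF that]] K_nat[OF that] in auto)
  have unit: "\<exists>j. of_int (i * j) = (1::'a)" if "of_int i \<noteq> (0::'a)" for i
  proof -
    have "\<not> int p dvd i"
      using that by (metis of_int_eq_0_iff_char_dvd p_def)
    then have "coprime i (int p)"
      using p by (metis coprime_commute prime_imp_coprime prime_nat_int_transfer)
    then obtain j where "[i * j = 1] (mod int p)"
      using cong_solve_coprime_int by blast
    then have "int p dvd (i * j - 1)"
      by (simp add: cong_iff_dvd_diff)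
    then have "of_int (i * j - 1) = (0::'a)"
      by (metis of_int_eq_0_iff_char_dvd p_def)
    then show ?thesis
      by (auto intro!: exI[of _ j])
  qed
  have integer_mem: "of_int i \<in> K \<longleftrightarrow> int p dvd i" for i
  proof
    assume i: "of_int i \<in> K"
    show "int p dvd i"
    proof (rule ccontr)
      assume "\<not> int p dvd i"
      then have "of_int i \<noteq> (0::'a)"
        by (metis of_int_eq_0_iff_char_dvd p_def)
      from unit[OF this] obtain j where "of_int (i * j) = (1::'a)" ..
      then have "of_int j * of_int i = (1::'a)"
        by (simp add: mult.commute)
      then show False
        using K_int[OF i, of j] K(2) by simp
    qed
  next
    assume "int p dvd i"
    then show "of_int i \<in> K"
      using K_0 by (metis of_int_eq_0_iff_char_dvd p_def)
  qed
  have "\<exists>i. x - of_int i \<in> K" for x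
  proof (cases "x \<in> K")
    case True
    then show ?thesis
      by (auto intro!: exI[of _ 0])
  next
    case False
    \<comment> \<open>The subgroup generated by \<open>K\<close> and \<open>x\<close> contains \<open>1\<close>, and the coefficient of \<open>x\<close> is invertible.\<close>
    define L where "L = {k + of_int j * x | k j. k \<in> K}"
    have "subgroup L"
      unfolding subgroup_def
    proof (intro conjI ballI)
      show "0 \<in> L"
        unfolding L_def using K_0 by (auto intro!: exI[of _ 0])
    next
      fix u v assume "u \<in> L" "v \<in> L"
      then obtain k j k' j' where "u = k + of_int j * x" "v = k' + of_int j' * x" "k \<in> K" "k' \<in> K"
        unfolding L_def by auto
      then show "u - v \<in> L"
        unfolding L_def
        by (auto intro!: exI[of _ "k - k'"] exI[of _ "j - j'"] K_diff simp: algebra_simps)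
    qed
    moreover have "K \<subseteq> L"
    proof
      fix k assume "k \<in> K"
      then have "k + of_int 0 * x \<in> L"
        unfolding L_def by blast
      then show "k \<in> L"
        by simp
    qed
    moreover have "x \<in> L"
    proof -
      have "0 + of_int 1 * x \<in> L"
        unfolding L_def using K_0 by blast
      then show ?thesis
        by simp
    qed
    ultimately have "1 \<in> L"
      using maximal False by blast
    then obtain k j where kj: "k \<in> K" "1 = k + of_int j * x"
      unfolding L_def by auto
    then have "of_int j \<noteq> (0::'a)"
      using K(2) by auto
    from unit[OF this] obtain i where i: "of_int (j * i) = (1::'a)" ..
    \<comment> \<open>The inverse \<open>i\<close> of \<open>j\<close> is the representative of \<open>x\<close>: multiply \<open>1 = k + j * x\<close> by \<open>i\<close>.\<close>
    have "x - of_int i = of_int (j * i) * x - of_int i * (k + of_int j * x)"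
      using i kj(2) by simp
    also have "\<dots> = - (of_int i * k)"
      by (simp add: algebra_simps)
    finally have "x - of_int i \<in> K"
      using K_minus[OF K_int[OF kj(1)]] by simp
    then show ?thesis ..
  qed
  then obtain r where r: "x - of_int (r x) \<in> K" for x
    by metis
  have r_cong: "int p dvd r (x + y) - (r x + r y)" for x y
  proof -
    have "(x - of_int (r x)) + (y - of_int (r y)) - (x + y - of_int (r (x + y))) \<in> K"
      by (intro K_diff K_add r)
    then have "of_int (r (x + y) - (r x + r y)) \<in> K"
      by (simp add: algebra_simps)
    then show ?thesis
      by (simp only: integer_mem)
  qed
  define e where "e i = cis (2 * pi * of_int i / p)" for i
  have e_add: "e (i + j) = e i * e j" for i j
    by (simp add: e_def cis_mult distrib_left add_divide_distrib)
  have p0: "p > 1"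
    using p prime_gt_1_nat by blast
  have e_eq_1: "e i = 1 \<longleftrightarrow> int p dvd i" for i
  proof
    assume "e i = 1"
    then have "cos (2 * pi * of_int i / p) = 1"
      by (metis e_def cis.sel(1) one_complex.sel(1))
    then obtain k :: int where "2 * pi * of_int i / p = of_int k * 2 * pi"
      using cos_one_2pi_int by blast
    then have "real_of_int i = of_int (k * int p)"
      using p0 by (simp add: field_simps)
    then have "i = k * int p"
      by (simp only: of_int_eq_iff)
    then show "int p dvd i"
      by simp
  next
    assume "int p dvd i"
    then obtain k where "i = int p * k" ..
    then have "2 * pi * of_int i / p = 2 * pi * of_int k"
      using p0 by simp
    then show "e i = 1"
      by (simp only: e_def cis_multiple_2pi Ints_of_int)
  qed
  show ?thesis
  proof (intro exI)
    show "nontrivial_additive_character (\<lambda>x. e (r x))"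
    proof
      show "e (r (x + y)) = e (r x) * e (r y)" for x y
        using e_add[of "r (x + y) - (r x + r y)" "r x + r y"] e_eq_1 r_cong[of x y]
        by (simp add: e_add)
      show "norm (e (r x)) = 1" for x
        by (simp add: e_def)
      show "\<exists>x. e (r x) \<noteq> 1"
      proof (intro exI[of _ 1])
        have "\<not> int p dvd r 1"
          using r[of 1] K_add[OF r[of 1], of "of_int (r 1)"] integer_mem K(2) by auto
        then show "e (r 1) \<noteq> 1"
          by (simp add: e_eq_1)
      qed
    qed
  qed
qed

section \<open>Power maps on a finite field\<close>

lemma card_power_eq_le:
  fixes c :: "'a::{field,finite}"
  assumes "d > 0"
  shows "card {x. x ^ d = c} \<le> d"
proof -
  define P where "P = Polynomial.monom (1::'a) d + [:- c:]"
  have deg: "degree P = d"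
    unfolding P_def using assms
    by (simp add: degree_add_eq_left degree_monom_eq)
  then have "P \<noteq> 0"
    using assms by auto
  then have "card {x. poly P x = 0} \<le> d"
    using card_poly_roots_bound[of P] deg by simp
  then show ?thesis
    by (simp add: P_def poly_monom)
qed

lemma finite_field_power_eq_1:
  fixes x :: "'a::{field,finite}"
  assumes "x \<noteq> 0"
  shows "x ^ (CARD('a) - 1) = 1"
proof -
  have "(\<Prod>y\<in>UNIV - {0}. y) = (\<Prod>y\<in>UNIV - {0}. x * y)"
    by (rule prod.reindex_bij_witness[of _ "\<lambda>y. x * y" "\<lambda>y. y / x"]) (use assms in auto)
  also have "\<dots> = x ^ (CARD('a) - 1) * (\<Prod>y\<in>UNIV - {0}. y)"
    by (simp add: prod.distrib card_Diff_subset)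
  finally show ?thesis
    by simp
qed

text \<open>
  The nonzero elements, \<open>d * e\<close> in number, are distributed over at most \<open>e\<close> fibres, one for each root of
  \<open>y ^ e = 1\<close>, and no fibre has more than \<open>d\<close> elements. Hence every fibre is full.
\<close>

lemma card_power_fibre:
  fixes c :: "'a::{field,finite}"
  assumes de: "d * e = CARD('a) - 1" and c: "c ^ e = 1"
  shows "card {x. x ^ d = c} = d"
proof (rule antisym)
  have "CARD('a) \<ge> 2"
    using card_mono[of UNIV "{0, 1::'a}"] by simp
  then have "d * e > 0"
    using de by simp
  then have d: "d > 0" and e: "e > 0"
    by auto
  show "card {x. x ^ d = c} \<le> d"
    by (rule card_power_eq_le[OF d])
  define T where "T = {y::'a. y ^ e = 1}"
  have cT: "c \<in> T"
    using c by (simp add: T_def)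
  have "d * e = card (UNIV - {0::'a})"
    by (simp add: de card_Diff_subset)
  also have "\<dots> \<le> card (\<Union>y\<in>T. {x. x ^ d = y})"
  proof (intro card_mono subsetI)
    fix x :: 'a assume "x \<in> UNIV - {0}"
    then have "(x ^ d) ^ e = 1"
      using finite_field_power_eq_1[of x] by (simp add: de flip: power_mult)
    then show "x \<in> (\<Union>y\<in>T. {x. x ^ d = y})"
      by (simp add: T_def)
  qed simp
  also have "\<dots> \<le> (\<Sum>y\<in>T. card {x. x ^ d = y})"
    by (rule card_UN_le) simp
  also have "\<dots> = card {x. x ^ d = c} + (\<Sum>y\<in>T - {c}. card {x. x ^ d = y})"
    using cT by (simp add: sum.remove)
  also have "\<dots> \<le> card {x. x ^ d = c} + (\<Sum>y\<in>T - {c}. d)"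
    by (intro add_left_mono sum_mono card_power_eq_le d)
  also have "\<dots> \<le> card {x. x ^ d = c} + (e - 1) * d"
    using cT card_power_eq_le[OF e, of "1::'a"] by (simp add: T_def diff_le_mono)
  finally have "d * e \<le> card {x. x ^ d = c} + (d * e - d)"
    by (simp add: algebra_simps diff_mult_distrib)
  moreover have "d \<le> d * e"
    using e by simp
  ultimately show "d \<le> card {x. x ^ d = c}"
    by linarith
qed

text \<open>Coordinates in a basis identify the larger field with the functions from the basis to the smaller field.\<close>

lemma card_extension_field:
  fixes \<iota> :: "'k::{field,finite} \<Rightarrow> 'l::{field,finite}"
  assumes "field_embedding \<iota>"
  shows "CARD('l) = CARD('k) ^ extension_degree \<iota>"
proof -
  interpret field_embedding \<iota> by fact
  interpret V: vector_space "\<lambda>c x. \<iota> c * x" by (rule vector_space)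
  obtain B where B: "V.independent B" "UNIV \<subseteq> V.span B" "card B = V.dim UNIV"
    using V.basis_exists[of UNIV] by metis
  have fin: "finite B" by simp
  define f where "f u = (\<Sum>v\<in>B. \<iota> (u v) * v)" for u
  have "inj_on f (B \<rightarrow>\<^sub>E UNIV)"
  proof (rule inj_onI)
    fix u w assume uw: "u \<in> B \<rightarrow>\<^sub>E UNIV" "w \<in> B \<rightarrow>\<^sub>E UNIV" "f u = f w"
    have "(\<Sum>v\<in>B. \<iota> (u v - w v) * v) = 0"
      using uw(3) by (simp add: f_def V.scale_left_diff_distrib sum_subtractf)
    then have "u v - w v = 0" if "v \<in> B" for v
      using V.independentD[OF B(1) fin order_refl, of "\<lambda>v. u v - w v"] that by blast
    then show "u = w"
      using uw(1,2) by (intro PiE_ext) auto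
  qed
  moreover have "f ` (B \<rightarrow>\<^sub>E UNIV) = UNIV"
  proof -
    have "x \<in> f ` (B \<rightarrow>\<^sub>E UNIV)" for x
    proof -
      obtain u where "x = f u"
        using B(2) V.span_finite[OF fin] unfolding f_def by blast
      also have "f u = f (restrict u B)"
        by (simp add: f_def)
      finally show ?thesis
        by auto
    qed
    then show ?thesis
      by auto
  qed
  ultimately have "CARD('l) = card (B \<rightarrow>\<^sub>E (UNIV :: 'k set))"
    by (metis card_image)
  then show ?thesis
    using B(3) by (simp add: card_funcsetE extension_degree_def)
qed

section \<open>Prescribed norms in sumsets\<close>

text \<open>
  The fibre over \<open>c\<close> is stable under the \<open>d\<close>-th roots of unity, and there are as many of these as
  elements of the fibre. So the Fourier bound applies to it.
\<close>

lemma sumset_meets_power_fibre: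
  fixes c :: "'a::{field,finite}" and A B :: "'a set"
  assumes de: "d * e = CARD('a) - 1" and c: "c ^ e = 1"
    and large: "CARD('a) ^ 3 < d\<^sup>2 * (card A * card B)"
  shows "\<exists>x\<in>A. \<exists>y\<in>B. (x + y) ^ d = c"
proof (rule ccontr)
  assume no: "\<not> ?thesis"
  obtain \<psi> :: "'a \<Rightarrow> complex" where "nontrivial_additive_character \<psi>"
    using exists_nontrivial_additive_character by blast
  then interpret nontrivial_additive_character \<psi> .
  define S where "S = {x. x ^ d = c}"
  define H where "H = {x::'a. x ^ d = 1}"
  have d: "d > 0"
    using large by (cases d) auto
  have card_S: "card S = d" and card_H: "card H = d"
    unfolding S_def H_def using card_power_fibre[OF de] c by auto
  have H_0: "0 \<notin> H"
    using d by (simp add: H_def zero_power)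
  have stable: "(*) h ` S = S" if "h \<in> H" for h
  proof (rule card_subset_eq)
    show "(*) h ` S \<subseteq> S"
      using that by (auto simp: S_def H_def power_mult_distrib)
    have "inj_on ((*) h) S"
      using that H_0 by (auto simp: inj_on_def)
    then show "card ((*) h ` S) = card S"
      by (rule card_image)
  qed simp
  have "(norm (fourier S b))\<^sup>2 \<le> CARD('a)" if "b \<noteq> 0" for b
    using fourier_bound_of_dilation_invariant[OF stable H_0 _ that] card_S card_H by simp
  then have "(card S)\<^sup>2 * (card A * card B) \<le> CARD('a) ^ 3"
    using no by (intro sumset_avoidance_bound) (auto simp: S_def)
  then show False
    using large card_S by simp
qed

theorem theorem2p8:
  fixes \<iota> :: "'k::{field,finite} \<Rightarrow> 'l::{field,finite}"
    and p m q n :: nat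
    and lam :: 'k
    and A B :: "'l set"
  assumes "prime p" and "odd p" and "m \<ge> 1" and "q = p ^ m"
    and "CARD('k) = q"
    and "field_embedding \<iota>" and "extension_degree \<iota> = n"
    and "n \<ge> 2"
    and "lam \<noteq> 0"
    and "card A * card B \<ge> q ^ (n + 2)"
  shows "\<exists>X\<in>A. \<exists>Y\<in>B. norm_map q n (X + Y) = \<iota> lam"
proof -
  interpret field_embedding \<iota> by fact
  have q: "q \<ge> 2"
    using card_mono[of UNIV "{0, 1::'k}"] \<open>CARD('k) = q\<close> by simp
  have card_l: "CARD('l) = q ^ n"
    using card_extension_field[OF \<open>field_embedding \<iota>\<close>] \<open>CARD('k) = q\<close> \<open>extension_degree \<iota> = n\<close>
    by simp
  define d where "d = (\<Sum>i<n. q ^ i)"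
  have geometric: "d * (q - 1) + 1 = q ^ n"
    unfolding d_def
  proof (induction n)
    case (Suc n)
    have "(\<Sum>i<Suc n. q ^ i) * (q - 1) + 1 = q ^ n + q ^ n * (q - 1)"
      using Suc by (simp add: distrib_right)
    also have "\<dots> = q ^ Suc n"
      using q by (simp add: diff_mult_distrib2)
    finally show ?case .
  qed simp
  then have de: "d * (q - 1) = CARD('l) - 1"
    by (simp add: card_l flip: geometric)
  have \<iota>_power: "\<iota> (x ^ k) = \<iota> x ^ k" for x k
    by (induction k) (simp_all add: mult one)
  have c: "\<iota> lam ^ (q - 1) = 1"
    using finite_field_power_eq_1[OF \<open>lam \<noteq> 0\<close>] \<open>CARD('k) = q\<close> one by (metis \<iota>_power)
  \<comment> \<open>As \<open>n \<ge> 2\<close>, the exponents \<open>0\<close> and \<open>n - 1\<close> are distinct. The bound on \<open>card A * card B\<close> leaves no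
    slack, so the strictness is what yields the contradiction.\<close>
  have d_gt: "q ^ (n - 1) < d"
  proof -
    have "q ^ (n - 1) + q ^ 0 = (\<Sum>i\<in>{0, n - 1}. q ^ i)"
      using \<open>n \<ge> 2\<close> by simp
    also have "\<dots> \<le> d"
      unfolding d_def using \<open>n \<ge> 2\<close> by (intro sum_mono2) auto
    finally show ?thesis
      by simp
  qed
  have "CARD('l) ^ 3 = (q ^ (n - 1))\<^sup>2 * q ^ (n + 2)"
  proof -
    have "n * 3 = (n - 1) * 2 + (n + 2)"
      using \<open>n \<ge> 2\<close> by simp
    then show ?thesis
      by (simp only: card_l flip: power_mult power_add)
  qed
  also have "\<dots> < d\<^sup>2 * q ^ (n + 2)"
    using d_gt q by (simp add: power_strict_mono)
  also have "\<dots> \<le> d\<^sup>2 * (card A * card B)"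
    using assms(10) by simp
  finally have "\<exists>X\<in>A. \<exists>Y\<in>B. (X + Y) ^ d = \<iota> lam"
    by (rule sumset_meets_power_fibre[OF de c])
  then show ?thesis
    by (simp add: norm_map_def d_def power_sum)
qed

end
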